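(* Let $n\ge 2$ and $C_\ell\ge 1$ be integers, let $h=1/n$, $N_h=(n-1)^2$, and let $G_h=(\mathcal{V}_h,E_h)$ be the finite element connectivity graph (on $N_h$ vertices) with connectivity level $C_\ell$ defined in the context. Let $\sigma:\mathbb{R}\to\mathbb{R}$ be an activation function such that there exist $t_0\in\mathbb{R}$ and an open interval $U$ containing $t_0$ with $\sigma\in C^1(U)$ and $\sigma'(t_0)\neq0$. Then for every $M\in\mathrm{GL}_{N_h}(\mathbb{R})$, every nonempty compact set $K\subset\mathbb{R}^{N_h}$, and every $\varepsilon>0$, there exists a finite-depth $\sigma$-network $\mathcal{N}:\mathbb{R}^{N_h}\to\mathbb{R}^{N_h}$ whose weight matrices are $G_h$-sparse in every layer such that $$\sup_{x\in K}\|\mathcal{N}(x)-Mx\|_\infty<\varepsilon.$$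
   Context: Mesh and basis functions: On the unit square $(0,1)^2$ take the uniform Cartesian grid with spacing $h=1/n$ and nodes $\eta_{i,j}=(ih,jh)$, $0\le i,j\le n$. Each grid square is split into two right isosceles triangles by cutting along its diagonal from the top-left to the bottom-right corner (the same direction in all squares). The interior node index set is $\mathcal{V}_h=\{(i,j):1\le i,j\le n-1\}$, with $N_h=|\mathcal{V}_h|=(n-1)^2$; it is identified with $\{1,\dots,N_h\}$ via $(i,j)\mapsto (n-1)(j-1)+i$. For $(i,j)\in\mathcal{V}_h$, $\phi_{i,j}$ is the continuous piecewise linear nodal ("hat") basis function equal to $1$ at $\eta_{i,j}$ and $0$ at all other nodes. $|\cdot|$ denotes Lebesgue measure of a planar set. Patches and neighborhoods: $\mathcal{P}^{(1)}_{i,j}=\mathrm{supp}(\phi_{i,j})$, and for $t\ge1$, $\mathcal{P}^{(t+1)}_{i,j}=\bigcup\{\mathrm{supp}(\phi_{p,q}) : (p,q)\in\mathcal{V}_h,\ |\mathrm{supp}(\phi_{p,q})\cap\mathcal{P}^{(t)}_{i,j}|\neq0\}$. The level-$t$ neighborhood is $\mathcal{V}_t(i,j)=\{(p,q)\in\mathcal{V}_h : |\mathrm{supp}(\phi_{p,q})\cap\mathcal{P}^{(t)}_{i,j}|\neq 0\}$. Graph $G_h$: the simple undirected graph with vertex set $\mathcal{V}_h$ in which two distinct vertices $(i,j)$ and $(p,q)$ are adjacent if and only if $(p,q)\in\mathcal{V}_{C_\ell}(i,j)$. $G$-sparse matrices: for a simple undirected graph $G=(V,E)$ with $V$ identified with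 $\{1,\dots,N\}$, a matrix $W=(w_{ij})\in M_N(\mathbb{R})$ is $G$-sparse if for all $i\ne j$, $w_{ij}\neq 0$ implies $\{i,j\}\in E$ (diagonal entries are unrestricted). Networks: for an activation $\sigma:\mathbb{R}\to\mathbb{R}$ (applied componentwise), a $\sigma$-network $\mathbb{R}^{N}\to\mathbb{R}^{N}$ with all layers of width $N$ is a finite composition $A_{L}\circ\sigma\circ A_{L-1}\circ\cdots\circ\sigma\circ A_1$ of affine maps $A_\ell(z)=W^{(\ell)}z+b^{(\ell)}$ with weight matrices $W^{(\ell)}\in\mathbb{R}^{N\times N}$ and biases $b^{(\ell)}\in\mathbb{R}^N$; the last layer is affine, with no activation. *)

theory Defs
  imports "HOL-Analysis.Analysis"
begin

section \<open>The mesh and the hat functions\<close>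

definition node :: "nat \<Rightarrow> nat \<times> nat \<Rightarrow> real \<times> real" where
  "node n v = (real (fst v) / real n, real (snd v) / real n)"

definition inner_nodes :: "nat \<Rightarrow> (nat \<times> nat) set" where
  "inner_nodes n = {1..n-1} \<times> {1..n-1}"

text \<open>The cell with lower-left node \<open>(a, b)\<close> is cut along the diagonal from its top-left node
  \<open>(a, b + 1)\<close> to its bottom-right node \<open>(a + 1, b)\<close>.\<close>

definition lower_triangle :: "nat \<Rightarrow> nat \<Rightarrow> nat \<Rightarrow> (real \<times> real) set" where
  "lower_triangle n a b = convex hull {node n (a, b), node n (a + 1, b), node n (a, b + 1)}"

definition upper_triangle :: "nat \<Rightarrow> nat \<Rightarrow> nat \<Rightarrow> (real \<times> real) set" where
  "upper_triangle n a b = convex hull {node n (a + 1, b + 1), node n (a + 1, b), node n (a, b + 1)}"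

definition mesh :: "nat \<Rightarrow> (real \<times> real) set set" where
  "mesh n = (\<Union>a<n. \<Union>b<n. {lower_triangle n a b, upper_triangle n a b})"

definition affine_on :: "(real \<times> real) set \<Rightarrow> (real \<times> real \<Rightarrow> real) \<Rightarrow> bool" where
  "affine_on T f \<longleftrightarrow> (\<exists>L c. linear L \<and> (\<forall>p\<in>T. f p = L p + c))"

text \<open>Functions on the closed unit square are extended by zero to the whole plane.\<close>

definition is_hat :: "nat \<Rightarrow> nat \<times> nat \<Rightarrow> (real \<times> real \<Rightarrow> real) \<Rightarrow> bool" where
  "is_hat n v f \<longleftrightarrow>
     continuous_on ({0..1} \<times> {0..1}) f \<and>
     (\<forall>T\<in>mesh n. affine_on T f) \<and>
     (\<forall>w\<in>{0..n} \<times> {0..n}. f (node n w) = (if w = v then 1 else 0)) \<and>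
     (\<forall>p. p \<notin> {0..1} \<times> {0..1} \<longrightarrow> f p = 0)"

definition hat :: "nat \<Rightarrow> nat \<times> nat \<Rightarrow> real \<times> real \<Rightarrow> real" where
  "hat n v = (THE f. is_hat n v f)"

definition supp :: "(real \<times> real \<Rightarrow> real) \<Rightarrow> (real \<times> real) set" where
  "supp f = closure {p. f p \<noteq> 0}"


section \<open>Well-definedness of the hat functions\<close>

lemma triangle_cover:
  assumes n: "n > 0" and p: "p \<in> {0..1::real} \<times> {0..1::real}"
  obtains T where "T \<in> mesh n" "p \<in> T"
proof -
  obtain x y where xy: "p = (x, y)" by (cases p)
  have cell: "\<exists>a<n. real a \<le> real n * x \<and> n * x \<le> real a + 1" if "0 \<le> x" "x \<le> 1" for x :: real
  proof (cases "x = 1")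
    case True
    then show ?thesis using n by (intro exI[of _ "n - 1"]) (auto simp: of_nat_diff)
  next
    case False
    have lt: "n * x < n" using n that False by simp
    have nn: "0 \<le> n * x" using that by simp
    have "nat \<lfloor>n * x\<rfloor> < n" using lt nn by linarith
    moreover have "real (nat \<lfloor>n * x\<rfloor>) \<le> n * x" "n * x \<le> real (nat \<lfloor>n * x\<rfloor>) + 1"
      using nn by linarith+
    ultimately show ?thesis by (intro exI[of _ "nat \<lfloor>n * x\<rfloor>"] conjI)
  qed
  obtain a where a: "a < n" "real a \<le> n * x" "n * x \<le> real a + 1" using cell[of x] p xy by auto
  obtain b where b: "b < n" "real b \<le> n * y" "n * y \<le> real b + 1" using cell[of y] p xy by auto
  define s where "s = n * x - a"
  define t where "t = n * y - b"
  have st: "0 \<le> s" "s \<le> 1" "0 \<le> t" "t \<le> 1" using a b by (auto simp: s_def t_def)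
  have px: "x = (a + s) / n" "y = (b + t) / n" using n by (auto simp: s_def t_def)
  show thesis
  proof (cases "s + t \<le> 1")
    case True
    have "p \<in> lower_triangle n a b"
      unfolding lower_triangle_def convex_hull_3
      apply (rule CollectI, rule exI[of _ "1 - s - t"], rule exI[of _ s], rule exI[of _ t])
      using st True n by (auto simp: xy px node_def field_simps)
    then show thesis using a b that by (auto simp: mesh_def)
  next
    case False
    have "p \<in> upper_triangle n a b"
      unfolding upper_triangle_def convex_hull_3
      apply (rule CollectI, rule exI[of _ "s + t - 1"], rule exI[of _ "1 - t"], rule exI[of _ "1 - s"])
      using st False n by (auto simp: xy px node_def field_simps)
    then show thesis using a b that by (auto simp: mesh_def)
  qed
qed

lemma mesh_vertices:
  assumes "T \<in> mesh n"
  obtains u v w where "T = convex hull {node n u, node n v, node n w}"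
    "{u, v, w} \<subseteq> {0..n} \<times> {0..n}"
proof -
  from assms obtain a b where ab: "a < n" "b < n"
    and T: "T = lower_triangle n a b \<or> T = upper_triangle n a b"
    unfolding mesh_def by blast
  from T show thesis
  proof
    assume "T = lower_triangle n a b"
    then show thesis
      using ab by (intro that[of "(a, b)" "(a + 1, b)" "(a, b + 1)"]) (auto simp: lower_triangle_def)
  next
    assume "T = upper_triangle n a b"
    then show thesis
      using ab by (intro that[of "(a + 1, b + 1)" "(a + 1, b)" "(a, b + 1)"])
        (auto simp: upper_triangle_def)
  qed
qed

lemma affine_on_convex_comb:
  assumes "affine_on T f" and "{p, q, r} \<subseteq> T" and "a + b + c = 1"
    and "a *\<^sub>R p + b *\<^sub>R q + c *\<^sub>R r \<in> T"
  shows "f (a *\<^sub>R p + b *\<^sub>R q + c *\<^sub>R r) = a * f p + b * f q + c * f r"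
proof -
  obtain L d where L: "linear L" and f: "\<And>p. p \<in> T \<Longrightarrow> f p = L p + d"
    using assms(1) unfolding affine_on_def by blast
  have d: "d = a * d + b * d + c * d"
    using assms(3) by (metis distrib_right mult_1)
  show ?thesis
    using assms(2,4) d by (simp add: f linear_add[OF L] linear_scale[OF L] algebra_simps)
qed

lemma is_hat_unique:
  assumes n: "n > 0" and f: "is_hat n v f" and g: "is_hat n v g"
  shows "f = g"
proof
  fix p
  show "f p = g p"
  proof (cases "p \<in> {0..1} \<times> {0..1}")
    case False
    then show ?thesis using f g unfolding is_hat_def by metis
  next
    case True
    then obtain T where T: "T \<in> mesh n" "p \<in> T" using triangle_cover n by blast
    from T(1) obtain u1 u2 u3 where hull: "T = convex hull {node n u1, node n u2, node n u3}"
      and u: "{u1, u2, u3} \<subseteq> {0..n} \<times> {0..n}" by (rule mesh_vertices)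
    have V: "{node n u1, node n u2, node n u3} \<subseteq> T" unfolding hull by (rule hull_subset)
    from T(2) obtain a b c where abc: "a + b + c = 1"
      and p: "p = a *\<^sub>R node n u1 + b *\<^sub>R node n u2 + c *\<^sub>R node n u3"
      unfolding hull convex_hull_3 by auto
    have aff: "affine_on T f" "affine_on T g" using f g T(1) unfolding is_hat_def by blast+
    have "f (node n u) = g (node n u)" if "u \<in> {u1, u2, u3}" for u
      using f g u that unfolding is_hat_def by (metis subsetD)
    then show ?thesis
      using affine_on_convex_comb[OF aff(1) V abc] affine_on_convex_comb[OF aff(2) V abc] T(2) p
      by simp
  qed
qed

definition hat_formula :: "nat \<Rightarrow> nat \<times> nat \<Rightarrow> real \<times> real \<Rightarrow> real" where
  "hat_formula n v p =
     (let s = real n * fst p - real (fst v); t = real n * snd p - real (snd v)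
      in max 0 (1 - max \<bar>s\<bar> (max \<bar>t\<bar> \<bar>s + t\<bar>)))"

lemma hat_formula_shift:
  assumes "real n * fst p = real i + s" "real n * snd p = real j + t"
  shows "hat_formula n (i, j) p = max 0 (1 - max \<bar>s\<bar> (max \<bar>t\<bar> \<bar>s + t\<bar>))"
  using assms by (simp add: hat_formula_def Let_def)

lemma hat_formula_eq_0:
  assumes "1 \<le> \<bar>real n * fst p - real (fst v)\<bar> \<or> 1 \<le> \<bar>real n * snd p - real (snd v)\<bar>
    \<or> 1 \<le> \<bar>real n * fst p - real (fst v) + (real n * snd p - real (snd v))\<bar>"
  shows "hat_formula n v p = 0"
  using assms unfolding hat_formula_def Let_def by linarith

lemma affine_onI:
  assumes "\<And>p. p \<in> T \<Longrightarrow> f p = a * fst p + b * snd p + c"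
  shows "affine_on T f"
  unfolding affine_on_def
proof (intro exI conjI ballI)
  show "linear (\<lambda>p::real \<times> real. a * fst p + b * snd p)"
    by (rule linearI) (auto simp: algebra_simps)
qed (use assms in simp)

lemma lower_triangle_coords:
  assumes n: "n > 0" and p: "p \<in> lower_triangle n a b"
  obtains s t :: real where "0 \<le> s" "0 \<le> t" "s + t \<le> 1" "n * fst p = a + s" "n * snd p = b + t"
proof -
  obtain u s t where w: "0 \<le> u" "0 \<le> s" "0 \<le> t" and sum: "u + s + t = 1"
    and p': "p = u *\<^sub>R node n (a, b) + s *\<^sub>R node n (a + 1, b) + t *\<^sub>R node n (a, b + 1)"
    using p unfolding lower_triangle_def convex_hull_3 by blast
  have u: "u = 1 - s - t" using sum by simp
  have "n * fst p = a + s" "n * snd p = b + t"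
    using n unfolding p' u by (auto simp: node_def field_simps)
  then show thesis using w sum by (intro that[of s t]) auto
qed

lemma upper_triangle_coords:
  assumes n: "n > 0" and p: "p \<in> upper_triangle n a b"
  obtains s t :: real where "s \<le> 1" "t \<le> 1" "1 \<le> s + t" "n * fst p = a + s" "n * snd p = b + t"
proof -
  obtain u s t where w: "0 \<le> u" "0 \<le> s" "0 \<le> t" and sum: "u + s + t = 1"
    and p': "p = u *\<^sub>R node n (a + 1, b + 1) + s *\<^sub>R node n (a + 1, b) + t *\<^sub>R node n (a, b + 1)"
    using p unfolding upper_triangle_def convex_hull_3 by blast
  have u: "u = 1 - s - t" using sum by simp
  have "n * fst p = a + (1 - t)" "n * snd p = b + (1 - s)"
    using n unfolding p' u by (auto simp: node_def field_simps)
  then show thesis using w sum by (intro that[of "1 - t" "1 - s"]) auto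
qed

lemma hat_formula_affine_lower:
  assumes n: "n > 0"
  shows "affine_on (lower_triangle n a b) (hat_formula n (i, j))"
proof -
  consider "a = i \<and> b = j" | "a = i \<and> b + 1 = j" | "a + 1 = i \<and> b = j"
    | "a \<ge> i + 1 \<or> a + 2 \<le> i \<or> b \<ge> j + 1 \<or> b + 2 \<le> j \<or> a + 1 = i \<and> b + 1 = j"
    by linarith
  then show ?thesis
  proof cases
    case 1
    show ?thesis
    proof (rule affine_onI[of _ _ "- real n" "- real n" "1 + real i + real j"])
      fix p assume "p \<in> lower_triangle n a b"
      with n obtain s t :: real where st: "0 \<le> s" "0 \<le> t" "s + t \<le> 1"
        and p: "real n * fst p = a + s" "real n * snd p = b + t"
        by (rule lower_triangle_coords)
      have q: "real n * fst p = real i + (s)" "real n * snd p = real j + (t)"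
        using p 1 by auto
      show "hat_formula n (i, j) p = (- real n) * fst p + (- real n) * snd p + (1 + real i + real j)"
        unfolding hat_formula_shift[OF q] using st q by (simp add: max_def abs_if)
    qed
  next
    case 2
    show ?thesis
    proof (rule affine_onI[of _ _ "0" "real n" "1 - real j"])
      fix p assume "p \<in> lower_triangle n a b"
      with n obtain s t :: real where st: "0 \<le> s" "0 \<le> t" "s + t \<le> 1"
        and p: "real n * fst p = a + s" "real n * snd p = b + t"
        by (rule lower_triangle_coords)
      have q: "real n * fst p = real i + (s)" "real n * snd p = real j + (t - 1)"
        using p 2 by auto
      show "hat_formula n (i, j) p = (0) * fst p + (real n) * snd p + (1 - real j)"
        unfolding hat_formula_shift[OF q] using st q by (simp add: max_def abs_if)
    qed
  next
    case 3
    show ?thesis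
    proof (rule affine_onI[of _ _ "real n" "0" "1 - real i"])
      fix p assume "p \<in> lower_triangle n a b"
      with n obtain s t :: real where st: "0 \<le> s" "0 \<le> t" "s + t \<le> 1"
        and p: "real n * fst p = a + s" "real n * snd p = b + t"
        by (rule lower_triangle_coords)
      have q: "real n * fst p = real i + (s - 1)" "real n * snd p = real j + (t)"
        using p 3 by auto
      show "hat_formula n (i, j) p = (real n) * fst p + (0) * snd p + (1 - real i)"
        unfolding hat_formula_shift[OF q] using st q by (simp add: max_def abs_if)
    qed
  next
    case 4
    show ?thesis
    proof (rule affine_onI[of _ _ "0" "0" "0"])
      fix p assume "p \<in> lower_triangle n a b"
      with n obtain s t :: real where st: "0 \<le> s" "0 \<le> t" "s + t \<le> 1"
        and p: "real n * fst p = a + s" "real n * snd p = b + t"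
        by (rule lower_triangle_coords)
      have "hat_formula n (i, j) p = 0"
        by (rule hat_formula_eq_0) (use 4 st p in auto)
      then show "hat_formula n (i, j) p = (0) * fst p + (0) * snd p + (0)" by simp
    qed
  qed
qed

lemma hat_formula_affine_upper:
  assumes n: "n > 0"
  shows "affine_on (upper_triangle n a b) (hat_formula n (i, j))"
proof -
  consider "a + 1 = i \<and> b + 1 = j" | "a = i \<and> b + 1 = j" | "a + 1 = i \<and> b = j"
    | "a \<ge> i + 1 \<or> a + 2 \<le> i \<or> b \<ge> j + 1 \<or> b + 2 \<le> j \<or> a = i \<and> b = j"
    by linarith
  then show ?thesis
  proof cases
    case 1
    show ?thesis
    proof (rule affine_onI[of _ _ "real n" "real n" "1 - real i - real j"])
      fix p assume "p \<in> upper_triangle n a b"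
      with n obtain s t :: real where st: "s \<le> 1" "t \<le> 1" "1 \<le> s + t"
        and p: "real n * fst p = a + s" "real n * snd p = b + t"
        by (rule upper_triangle_coords)
      have q: "real n * fst p = real i + (s - 1)" "real n * snd p = real j + (t - 1)"
        using p 1 by auto
      show "hat_formula n (i, j) p = (real n) * fst p + (real n) * snd p + (1 - real i - real j)"
        unfolding hat_formula_shift[OF q] using st q by (simp add: max_def abs_if)
    qed
  next
    case 2
    show ?thesis
    proof (rule affine_onI[of _ _ "- real n" "0" "1 + real i"])
      fix p assume "p \<in> upper_triangle n a b"
      with n obtain s t :: real where st: "s \<le> 1" "t \<le> 1" "1 \<le> s + t"
        and p: "real n * fst p = a + s" "real n * snd p = b + t"
        by (rule upper_triangle_coords)
      have q: "real n * fst p = real i + (s)" "real n * snd p = real j + (t - 1)"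
        using p 2 by auto
      show "hat_formula n (i, j) p = (- real n) * fst p + (0) * snd p + (1 + real i)"
        unfolding hat_formula_shift[OF q] using st q by (simp add: max_def abs_if)
    qed
  next
    case 3
    show ?thesis
    proof (rule affine_onI[of _ _ "0" "- real n" "1 + real j"])
      fix p assume "p \<in> upper_triangle n a b"
      with n obtain s t :: real where st: "s \<le> 1" "t \<le> 1" "1 \<le> s + t"
        and p: "real n * fst p = a + s" "real n * snd p = b + t"
        by (rule upper_triangle_coords)
      have q: "real n * fst p = real i + (s - 1)" "real n * snd p = real j + (t)"
        using p 3 by auto
      show "hat_formula n (i, j) p = (0) * fst p + (- real n) * snd p + (1 + real j)"
        unfolding hat_formula_shift[OF q] using st q by (simp add: max_def abs_if)
    qed
  next
    case 4
    show ?thesis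
    proof (rule affine_onI[of _ _ "0" "0" "0"])
      fix p assume "p \<in> upper_triangle n a b"
      with n obtain s t :: real where st: "s \<le> 1" "t \<le> 1" "1 \<le> s + t"
        and p: "real n * fst p = a + s" "real n * snd p = b + t"
        by (rule upper_triangle_coords)
      have "hat_formula n (i, j) p = 0"
        by (rule hat_formula_eq_0) (use 4 st p in auto)
      then show "hat_formula n (i, j) p = (0) * fst p + (0) * snd p + (0)" by simp
    qed
  qed
qed

lemma is_hat_formula:
  assumes v: "v \<in> inner_nodes n"
  shows "is_hat n v (hat_formula n v)"
proof -
  obtain i j where ij: "v = (i, j)" by (cases v)
  have i: "1 \<le> i" "i + 1 \<le> n" and j: "1 \<le> j" "j + 1 \<le> n"
    using v by (auto simp: inner_nodes_def ij)
  have n: "n > 0" using i by simp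
  show ?thesis
    unfolding is_hat_def
  proof (intro conjI ballI allI impI)
    show "continuous_on ({0..1} \<times> {0..1}) (hat_formula n v)"
      unfolding hat_formula_def Let_def by (intro continuous_intros)
  next
    fix T assume "T \<in> mesh n"
    then show "affine_on T (hat_formula n v)"
      using hat_formula_affine_lower[OF n] hat_formula_affine_upper[OF n]
      by (auto simp: mesh_def ij)
  next
    fix w assume "w \<in> {0..n} \<times> {0..n}"
    have eq: "n * fst (node n w) = fst w" "n * snd (node n w) = snd w"
      using n by (auto simp: node_def)
    show "hat_formula n v (node n w) = (if w = v then 1 else 0)"
    proof (cases "w = v")
      case True
      then show ?thesis using eq by (simp add: hat_formula_def Let_def)
    next
      case False
      then have "1 \<le> \<bar>real (fst w) - fst v\<bar> \<or> 1 \<le> \<bar>real (snd w) - snd v\<bar>"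
        by (auto simp: prod_eq_iff)
      then have "hat_formula n v (node n w) = 0"
        by (intro hat_formula_eq_0) (auto simp: eq)
      then show ?thesis using False by simp
    qed
  next
    fix p :: "real \<times> real"
    assume "p \<notin> {0..1} \<times> {0..1}"
    then consider "fst p < 0" | "fst p > 1" | "snd p < 0" | "snd p > 1"
      by (cases p) (auto simp: not_le)
    then show "hat_formula n v p = 0"
    proof cases
      case 1
      then have "n * fst p \<le> 0" by (simp add: mult_nonneg_nonpos)
      then show ?thesis using i by (intro hat_formula_eq_0) (auto simp: ij)
    next
      case 2
      then have "real n * 1 \<le> real n * fst p" by (intro mult_left_mono) auto
      then have "real i + 1 \<le> real n * fst p" using i by linarith
      then show ?thesis using i by (intro hat_formula_eq_0) (auto simp: ij)
    next
      case 3
      then have "n * snd p \<le> 0" by (simp add: mult_nonneg_nonpos)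
      then show ?thesis using j by (intro hat_formula_eq_0) (auto simp: ij)
    next
      case 4
      then have "real n * 1 \<le> real n * snd p" by (intro mult_left_mono) auto
      then have "real j + 1 \<le> real n * snd p" using j by linarith
      then show ?thesis using j by (intro hat_formula_eq_0) (auto simp: ij)
    qed
  qed
qed

lemma hat_eq_formula:
  assumes "v \<in> inner_nodes n"
  shows "hat n v = hat_formula n v"
proof -
  have "n > 0" using assms by (cases v) (auto simp: inner_nodes_def)
  then show ?thesis
    unfolding hat_def using is_hat_formula[OF assms] is_hat_unique by blast
qed

lemma ex1_hat:
  assumes "v \<in> inner_nodes n"
  shows "\<exists>!f. is_hat n v f" and "is_hat n v (hat n v)"
proof -
  have "n > 0" using assms by (cases v) (auto simp: inner_nodes_def)
  then show "\<exists>!f. is_hat n v f"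
    using is_hat_formula[OF assms] is_hat_unique by blast
  then show "is_hat n v (hat n v)" unfolding hat_def by (rule theI')
qed


section \<open>The finite element connectivity graph\<close>

text \<open>Levels start at 1; the value at level 0 is a dummy.\<close>

fun patch :: "nat \<Rightarrow> nat \<Rightarrow> nat \<times> nat \<Rightarrow> (real \<times> real) set" where
  "patch n 0 v = {}"
| "patch n (Suc 0) v = supp (hat n v)"
| "patch n (Suc (Suc t)) v =
     \<Union>{supp (hat n w) | w. w \<in> inner_nodes n \<and>
         emeasure lebesgue (supp (hat n w) \<inter> patch n (Suc t) v) \<noteq> 0}"

definition neighborhood :: "nat \<Rightarrow> nat \<Rightarrow> nat \<times> nat \<Rightarrow> (nat \<times> nat) set" where
  "neighborhood n t v =
     {w \<in> inner_nodes n. emeasure lebesgue (supp (hat n w) \<inter> patch n t v) \<noteq> 0}"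

definition fem_edges :: "nat \<Rightarrow> nat \<Rightarrow> (nat \<times> nat) set set" where
  "fem_edges n C =
     {{v, w} | v w. v \<in> inner_nodes n \<and> w \<in> inner_nodes n \<and> v \<noteq> w \<and> w \<in> neighborhood n C v}"

definition node_number :: "nat \<Rightarrow> nat \<times> nat \<Rightarrow> nat" where
  "node_number n v = (n - 1) * (snd v - 1) + fst v"

text \<open>The edge set transported to the vertex set \<open>{1..(n-1)\<^sup>2}\<close>.\<close>

definition fem_graph :: "nat \<Rightarrow> nat \<Rightarrow> nat set set" where
  "fem_graph n C = (\<lambda>e. node_number n ` e) ` fem_edges n C"

lemma bij_betw_node_number: "bij_betw (node_number n) (inner_nodes n) {1..(n - 1)\<^sup>2}"
proof -
  define m where "m = n - 1"
  have inj: "inj_on (node_number n) (inner_nodes n)"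
  proof (rule inj_onI)
    fix v w assume v: "v \<in> inner_nodes n" and w: "w \<in> inner_nodes n"
      and eq: "node_number n v = node_number n w"
    obtain i j where v': "v = (i + 1, j + 1)" and i: "i < m" 
      using v by (cases v; cases "fst v"; cases "snd v") (auto simp: inner_nodes_def m_def)
    obtain k l where w': "w = (k + 1, l + 1)" and k: "k < m"
      using w by (cases w; cases "fst w"; cases "snd w") (auto simp: inner_nodes_def m_def)
    have e: "m * j + i = m * l + k" using eq by (simp add: v' w' node_number_def m_def)
    have "i = (m * j + i) mod m" "j = (m * j + i) div m" using i by auto
    moreover have "k = (m * l + k) mod m" "l = (m * l + k) div m" using k by auto
    ultimately show "v = w" using e v' w' by metis
  qed
  have sub: "node_number n ` inner_nodes n \<subseteq> {1..(n - 1)\<^sup>2}"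
  proof
    fix x assume "x \<in> node_number n ` inner_nodes n"
    then obtain i j where x: "x = m * (j - 1) + i" and i: "1 \<le> i" "i \<le> m" and j: "1 \<le> j" "j \<le> m"
      by (auto simp: inner_nodes_def m_def node_number_def)
    have "m * (j - 1) + i \<le> m * (j - 1) + m" using i by simp
    also have "\<dots> = m * j" using j by (simp add: diff_mult_distrib2)
    also have "\<dots> \<le> m * m" using j by simp
    finally show "x \<in> {1..(n - 1)\<^sup>2}" using x i by (auto simp: m_def power2_eq_square)
  qed
  have "card (node_number n ` inner_nodes n) = card {1..(n - 1)\<^sup>2}"
    using card_image[OF inj] by (simp add: inner_nodes_def card_cartesian_product power2_eq_square)
  then have "node_number n ` inner_nodes n = {1..(n - 1)\<^sup>2}"
    using sub by (intro card_subset_eq) auto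
  then show ?thesis using inj by (simp add: bij_betw_def)
qed


section \<open>Sparse matrices and networks\<close>

text \<open>The index type \<open>'N\<close> carries no labels, so \<open>e\<close> gives the position in \<open>{1..CARD('N)}\<close> of each
  index.\<close>

definition g_sparse :: "('N \<Rightarrow> nat) \<Rightarrow> nat set set \<Rightarrow> real^'N^'N \<Rightarrow> bool" where
  "g_sparse e E W \<longleftrightarrow> (\<forall>a b. a \<noteq> b \<and> W $ a $ b \<noteq> 0 \<longrightarrow> {e a, e b} \<in> E)"

text \<open>A network is the list of its layers \<open>(W, b)\<close>, first applied layer first. Networks have at
  least one layer; the value at the empty list is a dummy.\<close>

fun network :: "(real \<Rightarrow> real) \<Rightarrow> ((real^'N^'N) \<times> (real^'N)) list \<Rightarrow> real^'N \<Rightarrow> real^'N" where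
  "network \<sigma> [] z = z"
| "network \<sigma> [(W, b)] z = W *v z + b"
| "network \<sigma> ((W, b) # l # ls) z = network \<sigma> (l # ls) (\<chi> a. \<sigma> ((W *v z + b) $ a))"

end

theory Submission
  imports Defs
begin

text \<open>The finite element graph is connected, because the hat functions of neighbouring grid nodes
  are both positive at the midpoint of the edge between them. For a connected graph, transvections
  along edges generate all transvections through commutators
  \<open>[1 + c E\<^sub>m\<^sub>p, 1 + E\<^sub>p\<^sub>k] = 1 + c E\<^sub>m\<^sub>k\<close> along paths, and together with the diagonal matrices they
  generate the general linear group; so \<open>M\<close> is a product of sparse matrices. Finally
  \<open>(\<sigma> (t0 + \<delta> y) - \<sigma> t0) / (\<delta> \<sigma>' t0)\<close> tends to \<open>y\<close> uniformly on bounded sets as \<open>\<delta> \<rightarrow> 0\<close>, so the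
  activations between the factors can be made nearly linear, the rescalings being absorbed into the
  adjacent affine layers without changing the sparsity.\<close>

section \<open>Factorization into sparse maps\<close>

text \<open>New factors enter on the input side, so induction peels off the matrix applied first,
  just as \<open>network\<close> peels off the head of its list.\<close>

inductive sparse_product :: "('N::finite \<Rightarrow> nat) \<Rightarrow> nat set set \<Rightarrow> (real^'N \<Rightarrow> real^'N) \<Rightarrow> bool"
  for e E where
  single: "g_sparse e E W \<Longrightarrow> sparse_product e E ((*v) W)"
| compose: "sparse_product e E f \<Longrightarrow> g_sparse e E W \<Longrightarrow> sparse_product e E (f \<circ> (*v) W)"

lemma sparse_product_comp:
  assumes "sparse_product e E g" "sparse_product e E f"
  shows "sparse_product e E (f \<circ> g)"
  using assms
  by (induction rule: sparse_product.induct) (auto intro: sparse_product.intros simp flip: comp_assoc)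

lemma sparse_product_linear: "sparse_product e E f \<Longrightarrow> linear f"
  by (induction rule: sparse_product.induct) (auto intro: linear_compose simp del: o_apply)

text \<open>Column \<open>b\<close> of \<open>matrix f\<close> is \<open>f (axis b 1)\<close>, so
  sparsity can be checked directly on maps given by coordinate formulas.\<close>

lemma sparse_product_linear_map:
  assumes "linear f" "\<And>a b. a \<noteq> b \<Longrightarrow> f (axis b 1) $ a \<noteq> 0 \<Longrightarrow> {e a, e b} \<in> E"
  shows "sparse_product e E f"
proof -
  have "g_sparse e E (matrix f)"
    using assms(2) by (auto simp: g_sparse_def matrix_def)
  then have "sparse_product e E ((*v) (matrix f))" by (rule single)
  moreover have "(*v) (matrix f) = f" using assms(1) by (auto intro: matrix_vector_mul)
  ultimately show ?thesis by simp
qed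

lemma sparse_product_diagonal: "sparse_product e E (\<lambda>x. \<chi> i. c i * x $ i)"
  by (rule sparse_product_linear_map)
    (auto intro!: linearI simp: vec_eq_iff algebra_simps axis_def)

text \<open>For \<open>m \<noteq> k\<close> this is the elementary matrix
  \<open>1 + c E\<^sub>m\<^sub>k\<close>, whose inverse has \<open>- c\<close> in place of
  \<open>c\<close>.\<close>

definition transvection :: "'N \<Rightarrow> 'N \<Rightarrow> real \<Rightarrow> real^'N \<Rightarrow> real^'N::finite" where
  "transvection m k c x = (\<chi> i. if i = m then x $ m + c * x $ k else x $ i)"

lemma sparse_product_transvection_edge:
  assumes "{e m, e k} \<in> E"
  shows "sparse_product e E (transvection m k c)"
  by (rule sparse_product_linear_map)
    (use assms in \<open>auto intro!: linearI
      simp: transvection_def vec_eq_iff algebra_simps axis_def split: if_splits\<close>)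

text \<open>For distinct indices
  \<open>E\<^sub>m\<^sub>p E\<^sub>p\<^sub>k = E\<^sub>m\<^sub>k\<close>, while the squares and the
  product in the other order vanish; only this term survives in the commutator.\<close>

lemma transvection_commutator:
  assumes "m \<noteq> p" "p \<noteq> k" "m \<noteq> k"
  shows "transvection m p c \<circ> transvection p k 1 \<circ> transvection m p (- c) \<circ> transvection p k (- 1)
    = transvection m k c"
  using assms by (auto simp: fun_eq_iff vec_eq_iff transvection_def algebra_simps)

lemma sparse_product_transvection:
  assumes "(m, k) \<in> {(a, b). a \<noteq> b \<and> {e a, e b} \<in> E}\<^sup>*" "m \<noteq> k"
  shows "sparse_product e E (transvection m k c)"
  using assms
proof (induction arbitrary: c rule: rtrancl_induct)
  case base
  then show ?case by simp
next
  case (step p k)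
  then have pk: "p \<noteq> k" and edge: "\<And>c. sparse_product e E (transvection p k c)"
    by (auto intro: sparse_product_transvection_edge)
  show ?case
  proof (cases "m = p")
    \<comment> \<open>A walk may return to its start; its last edge then joins \<open>m\<close> and
      \<open>k\<close> directly, where the commutator would lack distinct indices.\<close>
    case True
    then show ?thesis using edge by simp
  next
    case False
    show ?thesis
      unfolding transvection_commutator[OF False pk step.prems, symmetric]
      by (intro sparse_product_comp step.IH edge False)
  qed
qed

text \<open>The three transvections form the quarter turn taking the coordinates
  \<open>(x\<^sub>m, x\<^sub>k)\<close> to \<open>(x\<^sub>k, - x\<^sub>m)\<close>. The sign is
  corrected by a diagonal map, since transvections have determinant 1 and a transposition has
  -1.\<close>

lemma swap_as_transvections:
  assumes "m \<noteq> k"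
  shows "(\<lambda>x. \<chi> i. (if i = k then - 1 else 1) * x $ i) \<circ> transvection m k 1
      \<circ> transvection k m (- 1) \<circ> transvection m k 1
    = (\<lambda>x. \<chi> i. x $ Transposition.transpose m k i)"
  using assms by (auto simp: fun_eq_iff vec_eq_iff transvection_def Transposition.transpose_def)

text \<open>The elementary induction ranges over all linear maps, so bijectivity is carried as a
  premise of the claim. This makes the case of a vanishing coordinate vacuous, and in finite
  dimension it passes from a composition to both factors.\<close>

lemma sparse_product_bij:
  fixes e :: "'N::finite \<Rightarrow> nat" and f :: "real^'N \<Rightarrow> real^'N"
  assumes conn: "\<And>a b. (a, b) \<in> {(a, b). a \<noteq> b \<and> {e a, e b} \<in> E}\<^sup>*"
    and "linear f" "bij f"
  shows "sparse_product e E f"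
proof -
  have trans: "sparse_product e E (transvection m k c)" if "m \<noteq> k" for m k c
    using conn that by (rule sparse_product_transvection)
  have "bij f \<longrightarrow> sparse_product e E f"
    using \<open>linear f\<close>
  proof (rule induct_linear_elementary)
    fix f g :: "real^'N \<Rightarrow> real^'N"
    assume lin: "linear f" "linear g"
      and IH: "bij f \<longrightarrow> sparse_product e E f" "bij g \<longrightarrow> sparse_product e E g"
    show "bij (f \<circ> g) \<longrightarrow> sparse_product e E (f \<circ> g)"
    proof
      assume "bij (f \<circ> g)"
      then have "inj g" "surj f"
        by (auto simp: bij_def inj_on_def surj_def)
      then have "bij g" "bij f"
        using lin by (auto simp: bij_def linear_injective_imp_surjective linear_surjective_imp_injective)
      then show "sparse_product e E (f \<circ> g)"
        using IH by (intro sparse_product_comp) auto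
    qed
  next
    fix f :: "real^'N \<Rightarrow> real^'N" and i
    assume 0: "\<And>x. f x $ i = 0"
    show "bij f \<longrightarrow> sparse_product e E f"
    proof
      assume "bij f"
      then obtain x where "f x = axis i 1" by (metis bij_pointE)
      then show "sparse_product e E f" using 0[of x] by (simp add: axis_def)
    qed
  next
    fix c :: "'N \<Rightarrow> real"
    show "bij (\<lambda>x::real^'N. \<chi> i. c i * x $ i) \<longrightarrow> sparse_product e E (\<lambda>x. \<chi> i. c i * x $ i)"
      by (simp add: sparse_product_diagonal)
  next
    fix m k :: 'N
    assume "m \<noteq> k"
    then have "sparse_product e E (\<lambda>x. \<chi> i. x $ Transposition.transpose m k i)"
      unfolding swap_as_transvections[OF \<open>m \<noteq> k\<close>, symmetric]
      by (intro sparse_product_comp trans sparse_product_diagonal) auto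
    then show "bij (\<lambda>x::real^'N. \<chi> i. x $ Transposition.transpose m k i) \<longrightarrow>
        sparse_product e E (\<lambda>x. \<chi> i. x $ Transposition.transpose m k i)" ..
  next
    fix m k :: 'N
    assume "m \<noteq> k"
    then show "bij (\<lambda>x::real^'N. \<chi> i. if i = m then x $ m + x $ k else x $ i) \<longrightarrow>
        sparse_product e E (\<lambda>x. \<chi> i. if i = m then x $ m + x $ k else x $ i)"
      using trans[of m k 1] by (simp add: transvection_def[abs_def] cong: if_cong)
  qed
  with \<open>bij f\<close> show ?thesis by simp
qed


section \<open>Networks approximating compositions\<close>

text \<open>A scaling and shift of the input is absorbed into the first layer. The weight only
  changes by a scalar factor, which preserves its sparsity.\<close>

lemma network_affine_input:
  "network \<sigma> ((W, b) # ls) (c *\<^sub>R z + d) = network \<sigma> ((c *\<^sub>R W, W *v d + b) # ls) z"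
proof -
  have "W *v (c *\<^sub>R z + d) + b = (c *\<^sub>R W) *v z + (W *v d + b)"
    by (simp add: matrix_vector_right_distrib matrix_vector_mult_scaleR scaleR_matrix_vector_assoc)
  then show ?thesis by (cases ls) (auto simp: add.assoc)
qed

lemma rescaled_activation_near_id:
  fixes \<sigma> :: "real \<Rightarrow> real"
  assumes der: "(\<sigma> has_real_derivative D) (at t0)" and D: "D \<noteq> 0" and "\<eta> > 0" "R > 0"
  obtains \<delta> where "\<delta> > 0"
    "\<And>y. \<bar>y\<bar> \<le> R \<Longrightarrow> \<bar>(\<sigma> (t0 + \<delta> * y) - \<sigma> t0) / (\<delta> * D) - y\<bar> \<le> \<eta>"
proof -
  \<comment> \<open>Chosen so that the remainder bound \<open>\<theta> * (\<delta> * R)\<close>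
    becomes exactly \<eta> after division by \<open>\<delta> * \<bar>D\<bar>\<close>.\<close>
  define \<theta> where "\<theta> = \<eta> * \<bar>D\<bar> / R"
  have \<theta>: "\<theta> > 0" using assms by (simp add: \<theta>_def)
  from der have "(\<sigma> has_derivative (\<lambda>h. D * h)) (at t0)"
    by (simp add: has_field_derivative_def)
  then obtain d where d: "d > 0"
    and near: "\<And>y. \<bar>y - t0\<bar> < d \<Longrightarrow> \<bar>\<sigma> y - \<sigma> t0 - D * (y - t0)\<bar> \<le> \<theta> * \<bar>y - t0\<bar>"
    using \<theta> unfolding has_derivative_within_alt by auto
  define \<delta> where "\<delta> = d / (2 * R)"
  have \<delta>: "\<delta> > 0" using d assms by (simp add: \<delta>_def)
  show thesis
  proof (rule that[OF \<delta>])
    fix y assume y: "\<bar>y\<bar> \<le> R"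
    have "\<bar>\<delta> * y\<bar> \<le> \<delta> * R" using y \<delta> by (simp add: abs_mult)
    also have "\<dots> < d" using d assms by (simp add: \<delta>_def)
    finally have "\<bar>\<sigma> (t0 + \<delta> * y) - \<sigma> t0 - D * (\<delta> * y)\<bar> \<le> \<theta> * \<bar>\<delta> * y\<bar>"
      using near[of "t0 + \<delta> * y"] by simp
    also have "\<dots> \<le> \<theta> * (\<delta> * R)"
      using y \<delta> \<theta> by (simp add: abs_mult)
    also have "\<dots> = \<eta> * \<bar>\<delta> * D\<bar>" using \<delta> assms by (simp add: \<theta>_def abs_mult)
    finally have le: "\<bar>\<sigma> (t0 + \<delta> * y) - \<sigma> t0 - D * (\<delta> * y)\<bar> \<le> \<eta> * \<bar>\<delta> * D\<bar>" .
    have "(\<sigma> (t0 + \<delta> * y) - \<sigma> t0) / (\<delta> * D) - y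
        = (\<sigma> (t0 + \<delta> * y) - \<sigma> t0 - D * (\<delta> * y)) / (\<delta> * D)"
      using \<delta> D by (simp add: field_simps)
    then show "\<bar>(\<sigma> (t0 + \<delta> * y) - \<sigma> t0) / (\<delta> * D) - y\<bar> \<le> \<eta>"
      using le \<delta> D by (simp add: abs_divide divide_le_eq)
  qed
qed

text \<open>The compact set is generalized in the induction because the later layers receive
  perturbed values of \<open>W *v x\<close>. They are therefore approximated on \<open>K'\<close>,
  the closed 1-neighbourhood of the image of \<open>K\<close>.\<close>

lemma sparse_product_approx:
  fixes e :: "'N::finite \<Rightarrow> nat" and K :: "(real^'N) set"
  assumes der: "(\<sigma> has_real_derivative D) (at t0)" and D: "D \<noteq> 0"
    and "sparse_product e E f" "compact K" "\<epsilon> > 0"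
  shows "\<exists>layers. layers \<noteq> [] \<and> (\<forall>(W, b)\<in>set layers. g_sparse e E W) \<and>
    (\<forall>x\<in>K. norm (network \<sigma> layers x - f x) \<le> \<epsilon>)"
  using assms(3-5)
proof (induction arbitrary: K \<epsilon> rule: sparse_product.induct)
  case (single W)
  then show ?case by (intro exI[of _ "[(W, 0)]"]) auto
next
  case (compose f W)
  have "linear f" using compose.hyps(1) by (rule sparse_product_linear)
  then obtain B where B: "B > 0" "\<And>x. norm (f x) \<le> B * norm x"
    using linear_bounded_pos by blast
  \<comment> \<open>The bound 1 keeps the perturbed point in \<open>K'\<close>; the other bound
    limits the error passed through \<open>f\<close> to \<open>\<epsilon> / 2\<close>. Dividing by
    \<open>CARD('N)\<close> below accounts for estimating the norm by the sum of the
    coordinates.\<close>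
  define \<rho> where "\<rho> = min 1 (\<epsilon> / (2 * B))"
  define \<eta> where "\<eta> = \<rho> / CARD('N)"
  have \<rho>: "\<rho> > 0" using B compose.prems by (simp add: \<rho>_def)
  have \<eta>: "\<eta> > 0" using \<rho> by (simp add: \<eta>_def)
  have WK: "compact ((*v) W ` K)"
    using compose.prems by (intro compact_continuous_image matrix_vector_mult_linear_continuous_on)
  then obtain R where R: "R > 0" "\<And>x. x \<in> K \<Longrightarrow> norm (W *v x) \<le> R"
    using compact_imp_bounded[OF WK] by (auto simp: bounded_pos)
  define K' where "K' = {y + z | y z. y \<in> (*v) W ` K \<and> z \<in> cball 0 1}"
  have "compact K'" unfolding K'_def by (intro compact_sums WK compact_cball)
  then obtain layers where layers: "layers \<noteq> []" "\<forall>(W, b)\<in>set layers. g_sparse e E W"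
    and approx: "\<And>x. x \<in> K' \<Longrightarrow> norm (network \<sigma> layers x - f x) \<le> \<epsilon> / 2"
    using compose.IH[of K' "\<epsilon> / 2"] compose.prems by auto
  obtain W2 b2 ls where ls: "layers = (W2, b2) # ls" using layers(1) by (cases layers) auto
  obtain \<delta> where \<delta>: "\<delta> > 0"
    and near: "\<And>y. \<bar>y\<bar> \<le> R \<Longrightarrow> \<bar>(\<sigma> (t0 + \<delta> * y) - \<sigma> t0) / (\<delta> * D) - y\<bar> \<le> \<eta>"
    using rescaled_activation_near_id[OF der D \<eta> R(1)] by blast
  define c where "c = 1 / (\<delta> * D)"
  define d :: "real^'N" where "d = (\<chi> i. - (c * \<sigma> t0))"
  \<comment> \<open>The new first layer places the activation at
    \<open>t0 + \<delta> * (W *v x) $ i\<close>; the modified second layer subtracts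
    \<open>\<sigma> t0\<close> and divides by \<open>\<delta> * D\<close>.\<close>
  define N where "N = (\<delta> *\<^sub>R W, \<chi> i. t0) # (c *\<^sub>R W2, W2 *v d + b2) # ls"
  define y where "y x = (\<chi> i. (\<sigma> (t0 + \<delta> * (W *v x) $ i) - \<sigma> t0) / (\<delta> * D))" for x
  have N: "network \<sigma> N x = network \<sigma> layers (y x)" for x
  proof -
    have "y x = c *\<^sub>R (\<chi> i. \<sigma> (((\<delta> *\<^sub>R W) *v x + (\<chi> i. t0)) $ i)) + d"
      by (simp add: y_def c_def d_def vec_eq_iff diff_divide_distrib add.commute
          flip: scaleR_matrix_vector_assoc)
    then show ?thesis by (simp add: N_def ls network_affine_input)
  qed
  have "norm (network \<sigma> N x - (f \<circ> (*v) W) x) \<le> \<epsilon>" if x: "x \<in> K" for x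
  proof -
    have "norm (y x - W *v x) \<le> (\<Sum>i\<in>UNIV. \<bar>(y x - W *v x) $ i\<bar>)" by (rule norm_le_l1_cart)
    also have "\<dots> \<le> (\<Sum>i\<in>(UNIV::'N set). \<eta>)"
    proof (rule sum_mono)
      fix i
      have "\<bar>(W *v x) $ i\<bar> \<le> R" using R(2)[OF x] component_le_norm_cart order_trans by blast
      then show "\<bar>(y x - W *v x) $ i\<bar> \<le> \<eta>" using near by (simp add: y_def)
    qed
    also have "\<dots> = \<rho>" by (simp add: \<eta>_def)
    finally have close: "norm (y x - W *v x) \<le> \<rho>" .
    have "y x \<in> K'"
      unfolding K'_def using close x
      by (intro CollectI exI[of _ "W *v x"] exI[of _ "y x - W *v x"]) (auto simp: \<rho>_def)
    then have 1: "norm (network \<sigma> layers (y x) - f (y x)) \<le> \<epsilon> / 2" by (rule approx)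
    have "norm (f (y x) - f (W *v x)) \<le> B * norm (y x - W *v x)"
      using B(2)[of "y x - W *v x"] by (simp add: linear_diff[OF \<open>linear f\<close>])
    also have "\<dots> \<le> B * (\<epsilon> / (2 * B))"
      using close B(1) by (intro mult_left_mono) (auto simp: \<rho>_def)
    also have "\<dots> = \<epsilon> / 2" using B(1) by simp
    finally have 2: "norm (f (y x) - f (W *v x)) \<le> \<epsilon> / 2" .
    show ?thesis using norm_diff_triangle_le[OF 1 2] by (simp add: N)
  qed
  moreover have "g_sparse e E (r *\<^sub>R A)" if "g_sparse e E A" for r and A :: "real^'N^'N"
    using that by (auto simp: g_sparse_def)
  then have "\<forall>(W, b)\<in>set N. g_sparse e E W"
    using layers(2) compose.hyps(2) by (auto simp: N_def ls)
  ultimately show ?case by (intro exI[of _ N]) (auto simp: N_def)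
qed


section \<open>Connectivity of the finite element graph\<close>

lemma continuous_hat_formula: "continuous_on UNIV (hat_formula n v)"
  unfolding hat_formula_def Let_def by (intro continuous_intros)

text \<open>The two hats are nonzero on a common open set around \<open>p\<close>, and a nonempty
  open set is not negligible. Closedness of \<open>S\<close> makes it measurable, so measure zero
  would mean negligible.\<close>

lemma emeasure_overlap_nonzero:
  assumes S: "closed S" and v: "v \<in> inner_nodes n" and w: "w \<in> inner_nodes n"
    and sub: "supp (hat n v) \<inter> supp (hat n w) \<subseteq> S"
    and p: "hat_formula n v p \<noteq> 0" "hat_formula n w p \<noteq> 0"
  shows "emeasure lebesgue S \<noteq> 0"
proof
  assume "emeasure lebesgue S = 0"
  then have "negligible S" using S by (simp add: negligible_iff_emeasure0)
  define O' where "O' = {p. hat_formula n v p \<noteq> 0} \<inter> {p. hat_formula n w p \<noteq> 0}"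
  have "O' \<subseteq> supp (hat n v) \<inter> supp (hat n w)"
    unfolding O'_def supp_def hat_eq_formula[OF v] hat_eq_formula[OF w]
    by (intro Int_mono closure_subset)
  with sub have "negligible O'" using \<open>negligible S\<close> negligible_subset by blast
  moreover have "open O'"
    unfolding O'_def by (intro open_Int open_Collect_neq continuous_hat_formula continuous_on_const)
  moreover have "p \<in> O'" using p by (simp add: O'_def)
  ultimately show False using open_not_negligible by blast
qed

lemma closed_supp: "closed (supp f)"
  by (simp add: supp_def)

lemma finite_inner_nodes: "finite (inner_nodes n)"
  by (simp add: inner_nodes_def)

lemma closed_patch: "closed (patch n t v)"
proof (induction n t v rule: patch.induct)
  case (3 n t v)
  have "finite {supp (hat n w) | w. w \<in> inner_nodes n \<and>
      emeasure lebesgue (supp (hat n w) \<inter> patch n (Suc t) v) \<noteq> 0}"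
    using finite_inner_nodes by (auto simp: Setcompr_eq_image intro: finite_subset)
  then show ?case by (auto intro!: closed_Union closed_supp)
qed (auto simp: closed_supp)

lemma hat_formula_center: "n > 0 \<Longrightarrow> hat_formula n v (node n v) \<noteq> 0"
  by (simp add: hat_formula_def node_def)

text \<open>At each level \<open>v\<close> itself qualifies for the union, its node witnessing the
  overlap. Hence neighbours at level 1 stay neighbours at every higher level.\<close>

lemma supp_subset_patch:
  assumes v: "v \<in> inner_nodes n"
  shows "supp (hat n v) \<subseteq> patch n (Suc t) v"
proof (induction t)
  case (Suc t)
  have "n > 0" using v by (auto simp: inner_nodes_def)
  then have "emeasure lebesgue (supp (hat n v) \<inter> patch n (Suc t) v) \<noteq> 0"
    using Suc v
    by (intro emeasure_overlap_nonzero[OF _ v v _ hat_formula_center hat_formula_center]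
        closed_Int closed_supp closed_patch) auto
  with v have "supp (hat n v) \<in> {supp (hat n w) | w. w \<in> inner_nodes n \<and>
      emeasure lebesgue (supp (hat n w) \<inter> patch n (Suc t) v) \<noteq> 0}" by blast
  then show ?case unfolding patch.simps by (rule Union_upper)
qed simp

lemma fem_edgeI:
  assumes "C \<ge> 1" and v: "v \<in> inner_nodes n" and w: "w \<in> inner_nodes n" and "v \<noteq> w"
    and p: "hat_formula n v p \<noteq> 0" "hat_formula n w p \<noteq> 0"
  shows "{v, w} \<in> fem_edges n C"
proof -
  obtain t where C: "C = Suc t" using assms(1) by (cases C) auto
  have "emeasure lebesgue (supp (hat n w) \<inter> patch n C v) \<noteq> 0"
    using supp_subset_patch[OF v, of t] unfolding C
    by (intro emeasure_overlap_nonzero[OF _ v w _ p] closed_Int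
        closed_supp closed_patch) auto
  then have "w \<in> neighborhood n C v" using w by (simp add: neighborhood_def)
  then show ?thesis using assms unfolding fem_edges_def by blast
qed

section \<open>Walks along grid lines\<close>

lemma fem_edge_right:
  assumes "C \<ge> 1" "(i, j) \<in> inner_nodes n" "(Suc i, j) \<in> inner_nodes n"
  shows "{(i, j), (Suc i, j)} \<in> fem_edges n C"
proof (rule fem_edgeI[OF assms])
  have n: "n > 0" using assms by (auto simp: inner_nodes_def)
  \<comment> \<open>The midpoint of the grid edge, where both hats equal 1/2.\<close>
  let ?p = "((real i + 1 / 2) / real n, real j / real n)"
  show "hat_formula n (i, j) ?p \<noteq> 0" "hat_formula n (Suc i, j) ?p \<noteq> 0"
    using n by (auto simp: hat_formula_def)
qed simp

lemma fem_edge_up: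
  assumes "C \<ge> 1" "(i, j) \<in> inner_nodes n" "(i, Suc j) \<in> inner_nodes n"
  shows "{(i, j), (i, Suc j)} \<in> fem_edges n C"
proof (rule fem_edgeI[OF assms])
  have n: "n > 0" using assms by (auto simp: inner_nodes_def)
  let ?p = "(real i / real n, (real j + 1 / 2) / real n)"
  show "hat_formula n (i, j) ?p \<noteq> 0" "hat_formula n (i, Suc j) ?p \<noteq> 0"
    using n by (auto simp: hat_formula_def)
qed simp

text \<open>The walk climbs the first column from \<open>(1, 1)\<close> to \<open>(1, j)\<close> and
  then follows row \<open>j\<close> to the right.\<close>

lemma fem_connected_origin:
  assumes C: "C \<ge> 1"
  shows "(i, j) \<in> inner_nodes n \<Longrightarrow> ((1, 1), (i, j)) \<in> {(v, w). v \<noteq> w \<and> {v, w} \<in> fem_edges n C}\<^sup>*"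
    (is "_ \<Longrightarrow> _ \<in> ?R\<^sup>*")
proof (induction i arbitrary: j)
  case 0
  then show ?case by (simp add: inner_nodes_def)
next
  case (Suc i)
  show ?case
  proof (cases "i = 0")
    case False
    then have in': "(i, j) \<in> inner_nodes n" using Suc.prems by (auto simp: inner_nodes_def)
    then have "((i, j), (Suc i, j)) \<in> ?R" using fem_edge_right[OF C in' Suc.prems] by simp
    with Suc.IH[OF in'] show ?thesis by (rule rtrancl_into_rtrancl)
  next
    \<comment> \<open>Inner indices start at 1, so \<open>Suc i\<close> is here the first column and
      an induction on the row index replaces the step to the left.\<close>
    case True
    have "((1, 1), (1, j)) \<in> ?R\<^sup>*" if "(1, j) \<in> inner_nodes n" for j
      using that
    proof (induction j)
      case 0
      then show ?case by (simp add: inner_nodes_def)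
    next
      case (Suc j)
      show ?case
      proof (cases "j = 0")
        case False
        then have in': "(1, j) \<in> inner_nodes n" using Suc.prems by (auto simp: inner_nodes_def)
        then have "((1, j), (1, Suc j)) \<in> ?R" using fem_edge_up[OF C in' Suc.prems] by simp
        with Suc.IH[OF in'] show ?thesis by (rule rtrancl_into_rtrancl)
      qed simp
    qed
    then show ?thesis using True Suc.prems by simp
  qed
qed

text \<open>By symmetry of adjacency, the walk from \<open>(1, 1)\<close> to \<open>v\<close> can be
  reversed and continued to \<open>w\<close>.\<close>

lemma fem_connected:
  assumes "C \<ge> 1" "v \<in> inner_nodes n" "w \<in> inner_nodes n"
  shows "(v, w) \<in> {(v, w). v \<noteq> w \<and> {v, w} \<in> fem_edges n C}\<^sup>*"
proof -
  let ?R = "{(v, w). v \<noteq> w \<and> {v, w} \<in> fem_edges n C}"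
  have "sym (?R\<^sup>*)" by (intro sym_rtrancl symI) (auto simp: insert_commute)
  then show ?thesis
    using fem_connected_origin[OF assms(1), of "fst v" "snd v" n]
      fem_connected_origin[OF assms(1), of "fst w" "snd w" n] assms
    by (auto dest: symD intro: rtrancl_trans)
qed

section \<open>Transport of connectivity to the matrix indices\<close>

lemma fem_graph_connected:
  assumes "C \<ge> 1" and e: "bij_betw e UNIV {1..(n - 1)\<^sup>2}"
  shows "(a, b) \<in> {(a, b). a \<noteq> b \<and> {e a, e b} \<in> fem_graph n C}\<^sup>*"
proof -
  let ?R = "{(v, w). v \<noteq> w \<and> {v, w} \<in> fem_edges n C}"
  let ?S = "{(a, b). a \<noteq> b \<and> {e a, e b} \<in> fem_graph n C}"
  \<comment> \<open>\<open>g\<close> sends a grid node to the index with the same number; it is onto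
    and carries edges to edges, so walks can be pushed forward along it.\<close>
  define g where "g v = inv e (node_number n v)" for v
  have eg: "e (g v) = node_number n v" if "v \<in> inner_nodes n" for v
    using that e bij_betw_node_number[of n] unfolding g_def
    by (intro f_inv_into_f) (auto simp: bij_betw_def)
  have surj: "\<exists>v\<in>inner_nodes n. g v = a" for a
  proof -
    have "e a \<in> node_number n ` inner_nodes n"
      using e bij_betw_node_number[of n] by (auto simp: bij_betw_def)
    then obtain v where v: "v \<in> inner_nodes n" "e a = node_number n v" by auto
    then have "g v = a" using e by (metis bij_betw_def eg inv_f_f g_def)
    with v show ?thesis by blast
  qed
  have edge: "(g v, g w) \<in> ?S" if "(v, w) \<in> ?R" for v w
  proof -
    have vw: "v \<in> inner_nodes n" "w \<in> inner_nodes n" "v \<noteq> w" "{v, w} \<in> fem_edges n C"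
      using that by (auto simp: fem_edges_def doubleton_eq_iff)
    have "{e (g v), e (g w)} \<in> fem_graph n C"
      using vw by (auto simp: eg fem_graph_def intro!: image_eqI[of _ _ "{v, w}"])
    moreover have "g v \<noteq> g w"
      using vw eg bij_betw_node_number[of n] by (metis bij_betw_def inj_onD)
    ultimately show ?thesis by simp
  qed
  obtain v w where vw: "v \<in> inner_nodes n" "w \<in> inner_nodes n" "g v = a" "g w = b"
    using surj by metis
  have "(g v, g w) \<in> ?S\<^sup>*"
    using fem_connected[OF assms(1) vw(1,2)]
  proof (induction rule: rtrancl_induct)
    case (step u w)
    from step.IH edge[OF step.hyps(2)] show ?case by (rule rtrancl_into_rtrancl)
  qed simp
  then show ?thesis using vw by simp
qed

theorem theorem4p15:
  fixes n C :: nat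
    and e :: "'N::finite \<Rightarrow> nat"
    and \<sigma> :: "real \<Rightarrow> real" and U :: "real set" and t0 :: real
    and M :: "real^'N^'N" and K :: "(real^'N) set" and \<epsilon> :: real
  assumes "n \<ge> 2" and "C \<ge> 1"
    and "bij_betw e UNIV {1..(n - 1)\<^sup>2}"
    and "open U" and "is_interval U" and "t0 \<in> U"
    and "\<sigma> C1_differentiable_on U" and "deriv \<sigma> t0 \<noteq> 0"
    and "invertible M"
    and "compact K" and "K \<noteq> {}"
    and "\<epsilon> > 0"
  shows "\<exists>layers. layers \<noteq> [] \<and>
           (\<forall>(W, b)\<in>set layers. g_sparse e (fem_graph n C) W) \<and>
           (SUP x\<in>K. ereal (infnorm (network \<sigma> layers x - M *v x))) < ereal \<epsilon>"
proof -
  have "\<sigma> differentiable (at t0)"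
    using C1_differentiable_on_eq assms(6,7) by blast
  then have der: "(\<sigma> has_real_derivative deriv \<sigma> t0) (at t0)"
    by (metis DERIV_deriv_iff_real_differentiable)
  have "bij ((*v) M)"
    using assms(9) by (simp add: invertible_eq_bij)
  then have "sparse_product e (fem_graph n C) ((*v) M)"
    by (intro sparse_product_bij fem_graph_connected assms) auto
  then obtain layers where layers: "layers \<noteq> []"
      "\<forall>(W, b)\<in>set layers. g_sparse e (fem_graph n C) W"
    and approx: "\<And>x. x \<in> K \<Longrightarrow> norm (network \<sigma> layers x - M *v x) \<le> \<epsilon> / 2"
    using sparse_product_approx[OF der assms(8) _ assms(10), of e _ _ "\<epsilon> / 2"] assms(12) by force
  \<comment> \<open>Approximation within \<open>\<epsilon> / 2\<close> keeps the inequality strict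
    after the supremum.\<close>
  have "(SUP x\<in>K. ereal (infnorm (network \<sigma> layers x - M *v x))) \<le> ereal (\<epsilon> / 2)"
    by (rule SUP_least) (simp only: ereal_less_eq, rule order_trans[OF infnorm_le_norm approx])
  also have "\<dots> < ereal \<epsilon>" using assms(12) by simp
  finally show ?thesis using layers by blast
qed

end
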